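(* For any typed term $t:T$, there is a term $t'$ such that $t$ reduces to $t'$ in a finite number of reduction steps and $t'$ contains no redexes.
   Context: Terms of the calculus: $t ::= \mathtt{True}\mid\mathtt{False}\mid x\mid \lambda x.t\mid tu\mid \{p_1t_1,\ldots,p_nt_n\}\mid \circlearrowright_n t\mid \langle t_1,\ldots,t_n\rangle\mid t\pi_j\mid \mathtt{Trust}?\,t$, with $n,j\geq 1$ and $p_i$ rationals summing to $1$; $\mathtt{Trust}?\,t$ carries an annotation $\mathcal{P}(\varepsilon)$ ($\mathcal{P}=q_1B_1,\ldots,q_mB_m$ types with rational weights summing to 1, $\varepsilon$ rational). Substitution $t[s/x]$: $x[s/x]=s$, $y[s/x]=y$ ($y\ne x$), constants unchanged, $(\lambda x.t)[s/x]=\lambda x.t$, $(\lambda y.t)[s/x]=\lambda y.t[s/x]$ ($y\neq x$), commuting with other constructors. Types: $A::= q\mid A\rightarrow B\mid \bigoplus_{i=1}^n A_i\mid (A)^n\mid \mathtt{Bool}(p_1B_1,\ldots,p_nB_n)(\varepsilon)$; $\bigoplus_{i=1}^1A_1$ identified with $A_1$. Subtyping $<:$: least reflexive transitive relation extending a given relation on atomic types with: $B_1<:A_1$, $A_2<:B_2$ imply $A_1\rightarrow A_2<:B_1\rightarrow B_2$; if each $A_j$ is a subtype of some $B_i$ then $\bigoplus_jA_j<:\bigoplus_iB_i$; $A<:B$, $m\ge n$ imply $(A)^m<:(B)^n$. Typing rules: $x:A$ for a variable of type $A$; $\mathtt{True},\mathtt{False}:\mathtt{Bool}\,\mathcal{P}(\varepsilon)$;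 $t:B$, $x:A$ give $\lambda x^A.t:A\rightarrow B$; $t_i:A_i$ (all $A_i$ subtypes of some $A$) give $\{p_1t_1,\ldots,p_nt_n\}:\bigoplus A_i$; $u:\bigoplus_{i=1}^n(C_i\rightarrow D_i)$, $v:C$ with $C<:C_i$ for all $i$ give $uv:\bigoplus D_i$; $t:A$ gives $\circlearrowright_nt:(A)^n$; $s_i:E_i$, $E_i<:E$ give $\langle s_1,\ldots,s_n\rangle:(E)^n$; $t:(A)^n$, $1\le j\le n$ give $t\pi_j:A$; $t:(A)^n$ gives $\mathtt{Trust}?\,t\,\mathcal{P}(\varepsilon):\mathtt{Bool}\,\mathcal{P}(\varepsilon)$. Values: $\mathtt{True}$, $\mathtt{False}$, $\lambda x.t$, tuples of values. $\mathrm{D}_{\mathrm{TV}}(\mathcal{P}\parallel\mathcal{P}')$: equal to $1$ if neither type set of $\mathcal{P},\mathcal{P}'$ contains the other; otherwise $\max_i|q_i-q'_i|$ over types $S_i$ in the union, $q_i,q'_i$ being the total weights of $S_i$ in $\mathcal{P},\mathcal{P}'$ (or 0). $\langle s_1,\ldots,s_n\rangle\approx q_1B_1,\ldots,q_mB_m$ iff all $s_i$ are values and for each $j$ exactly $q_j\cdot n$ of the types of the $s_i$ are subtypes of $B_j$. Redexes and basic reduction rules: $(\lambda x.t)u\mapsto_1 t[u/x]$; $\{p_1t_1,\ldots,p_nt_n\}\mapsto_{p_i}t_i$ ($1\le i\le n$); $\circlearrowright_ns\mapsto_1\langle s,\ldots,s\rangle$ ($n$ copies); $\langle s_1,\ldots,s_n\rangle\pi_i\mapsto_1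 s_i$; $\mathtt{Trust}?\langle s_1,\ldots,s_n\rangle\mathcal{P}(\varepsilon)\mapsto_1\mathtt{True}$ (resp. $\mathtt{False}$) if $\langle s_1,\ldots,s_n\rangle\approx\mathcal{P}'$ and $\mathrm{D}_{\mathrm{TV}}(\mathcal{P}\parallel\mathcal{P}')\le\varepsilon$ (resp. $>\varepsilon$). A redex is a term of one of the left-hand forms; a reduction step replaces an occurrence of a redex anywhere inside a term by a reductum. *)

theory Defs
  imports Complex_Main
begin

section \<open>Types\<close>

text \<open>
  The sum type with components \<open>A, B, Cs\<close> is \<open>TSum A B Cs\<close>: the constructor takes at least two
  components, because a one-component sum is identified with its component. Sums of
  arbitrary length \<open>n \<ge> 1\<close> are formed by \<open>oplus\<close> below. \<open>'a\<close> is the type of atomic types.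
\<close>

datatype 'a ty =
    Atom 'a
  | Arr "'a ty" "'a ty"
  | TSum "'a ty" "'a ty" "'a ty list"
  | Pow "'a ty" nat
  | TBool "(rat \<times> 'a ty) list" rat

type_synonym 'a dist = "(rat \<times> 'a ty) list"

fun oplus :: "'a ty list \<Rightarrow> 'a ty" where
  "oplus [A] = A"
| "oplus (A # B # Cs) = TSum A B Cs"
| "oplus [] = undefined"  \<comment> \<open>never used: all lists below are required to be nonempty\<close>

text \<open>
  The side conditions of the grammar: exponents are at least 1 and weights sum to 1
  (so that lists of weighted types are in particular nonempty).
\<close>

inductive wf_ty :: "'a ty \<Rightarrow> bool" where
  "wf_ty (Atom q)"
| "wf_ty A \<Longrightarrow> wf_ty B \<Longrightarrow> wf_ty (Arr A B)"
| "wf_ty A \<Longrightarrow> wf_ty B \<Longrightarrow> (\<forall>C\<in>set Cs. wf_ty C) \<Longrightarrow> wf_ty (TSum A B Cs)"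
| "wf_ty A \<Longrightarrow> 1 \<le> n \<Longrightarrow> wf_ty (Pow A n)"
| "(\<forall>(q, B)\<in>set P. wf_ty B) \<Longrightarrow> sum_list (map fst P) = 1 \<Longrightarrow> wf_ty (TBool P \<epsilon>)"

definition wf_dist :: "'a dist \<Rightarrow> bool" where
  "wf_dist P \<longleftrightarrow> (\<forall>(q, B)\<in>set P. wf_ty B) \<and> sum_list (map fst P) = 1"

text \<open>\<open>R\<close> is the given relation on atomic types.\<close>

inductive subty :: "('a \<Rightarrow> 'a \<Rightarrow> bool) \<Rightarrow> 'a ty \<Rightarrow> 'a ty \<Rightarrow> bool"
  for R :: "'a \<Rightarrow> 'a \<Rightarrow> bool" where
  sub_atom: "R q q' \<Longrightarrow> subty R (Atom q) (Atom q')"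
| sub_refl: "subty R A A"
| sub_trans: "subty R A B \<Longrightarrow> subty R B C \<Longrightarrow> subty R A C"
| sub_arr: "subty R B\<^sub>1 A\<^sub>1 \<Longrightarrow> subty R A\<^sub>2 B\<^sub>2 \<Longrightarrow> subty R (Arr A\<^sub>1 A\<^sub>2) (Arr B\<^sub>1 B\<^sub>2)"
| sub_sum: "As \<noteq> [] \<Longrightarrow> Bs \<noteq> [] \<Longrightarrow> (\<forall>A\<in>set As. \<exists>B\<in>set Bs. subty R A B)
    \<Longrightarrow> subty R (oplus As) (oplus Bs)"
| sub_pow: "subty R A B \<Longrightarrow> 1 \<le> n \<Longrightarrow> n \<le> m \<Longrightarrow> subty R (Pow A m) (Pow B n)"


section \<open>Terms\<close>

text \<open>
  Every variable carries its type, as in \<open>x\<^sup>A\<close>; two variables are equal iff both their names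
  and their types are.
\<close>

type_synonym 'a var = "nat \<times> 'a ty"

datatype 'a tm =
    Tru
  | Fls
  | Var "'a var"
  | Lam "'a var" "'a tm"
  | App "'a tm" "'a tm"
  | Choice "(rat \<times> 'a tm) list"
  | Iter nat "'a tm"
  | Tup "'a tm list"
  | Proj "'a tm" nat
  | Trust "'a tm" "'a dist" rat

text \<open>
  \<open>subst t s x\<close> is \<open>t[s/x]\<close>. There is no renaming of bound variables and no
  freshness condition in the clause for abstractions: terms are not taken modulo renaming.
\<close>

primrec subst :: "'a tm \<Rightarrow> 'a tm \<Rightarrow> 'a var \<Rightarrow> 'a tm" where
  "subst Tru s x = Tru"
| "subst Fls s x = Fls"
| "subst (Var y) s x = (if y = x then s else Var y)"
| "subst (Lam y t) s x = (if y = x then Lam y t else Lam y (subst t s x))"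
| "subst (App t u) s x = App (subst t s x) (subst u s x)"
| "subst (Choice pts) s x = Choice (map (map_prod id (\<lambda>t. subst t s x)) pts)"
| "subst (Iter n t) s x = Iter n (subst t s x)"
| "subst (Tup ts) s x = Tup (map (\<lambda>t. subst t s x) ts)"
| "subst (Proj t j) s x = Proj (subst t s x) j"
| "subst (Trust t P \<epsilon>) s x = Trust (subst t s x) P \<epsilon>"

text \<open>The side conditions of the term grammar are premises of the typing rules.\<close>

inductive typing :: "('a \<Rightarrow> 'a \<Rightarrow> bool) \<Rightarrow> 'a tm \<Rightarrow> 'a ty \<Rightarrow> bool"
  for R :: "'a \<Rightarrow> 'a \<Rightarrow> bool" where
  ty_var: "wf_ty A \<Longrightarrow> typing R (Var (x, A)) A"
| ty_tru: "wf_dist P \<Longrightarrow> typing R Tru (TBool P \<epsilon>)"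
| ty_fls: "wf_dist P \<Longrightarrow> typing R Fls (TBool P \<epsilon>)"
| ty_lam: "typing R t B \<Longrightarrow> wf_ty A \<Longrightarrow> typing R (Lam (x, A) t) (Arr A B)"
| ty_choice: "pts \<noteq> [] \<Longrightarrow> sum_list (map fst pts) = 1
    \<Longrightarrow> list_all2 (typing R) (map snd pts) As \<Longrightarrow> wf_ty A \<Longrightarrow> (\<forall>B\<in>set As. subty R B A)
    \<Longrightarrow> typing R (Choice pts) (oplus As)"
| ty_app: "CDs \<noteq> [] \<Longrightarrow> typing R u (oplus (map (\<lambda>(C, D). Arr C D) CDs)) \<Longrightarrow> typing R v C
    \<Longrightarrow> (\<forall>(C', D')\<in>set CDs. subty R C C') \<Longrightarrow> typing R (App u v) (oplus (map snd CDs))"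
| ty_iter: "typing R t A \<Longrightarrow> 1 \<le> n \<Longrightarrow> typing R (Iter n t) (Pow A n)"
| ty_tup: "ss \<noteq> [] \<Longrightarrow> list_all2 (typing R) ss Es \<Longrightarrow> wf_ty E \<Longrightarrow> (\<forall>E'\<in>set Es. subty R E' E)
    \<Longrightarrow> typing R (Tup ss) (Pow E (length ss))"
| ty_proj: "typing R t (Pow A n) \<Longrightarrow> 1 \<le> j \<Longrightarrow> j \<le> n \<Longrightarrow> typing R (Proj t j) A"
| ty_trust: "typing R t (Pow A n) \<Longrightarrow> wf_dist P \<Longrightarrow> typing R (Trust t P \<epsilon>) (TBool P \<epsilon>)"


section \<open>Reduction\<close>

inductive is_value :: "'a tm \<Rightarrow> bool" where
  "is_value Tru"
| "is_value Fls"
| "is_value (Lam x t)"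
| "(\<forall>s\<in>set ss. is_value s) \<Longrightarrow> is_value (Tup ss)"

definition dist_types :: "'a dist \<Rightarrow> 'a ty set" where
  "dist_types P = snd ` set P"

definition weight :: "'a dist \<Rightarrow> 'a ty \<Rightarrow> rat" where
  "weight P S = sum_list (map fst (filter (\<lambda>(q, B). B = S) P))"

definition D_TV :: "'a dist \<Rightarrow> 'a dist \<Rightarrow> rat" where
  "D_TV P P' =
    (if \<not> dist_types P \<subseteq> dist_types P' \<and> \<not> dist_types P' \<subseteq> dist_types P then 1
     else Max ((\<lambda>S. \<bar>weight P S - weight P' S\<bar>) ` (dist_types P \<union> dist_types P')))"

text \<open>
  A term may have several types; in \<open>approx\<close>, \<open>Ts\<close> assigns one type to each component,
  and the count is by components, so that equal types are counted with multiplicity.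
\<close>

definition approx :: "('a \<Rightarrow> 'a \<Rightarrow> bool) \<Rightarrow> 'a tm list \<Rightarrow> 'a dist \<Rightarrow> bool" where
  "approx R ss P \<longleftrightarrow> wf_dist P \<and> (\<forall>s\<in>set ss. is_value s) \<and>
    (\<exists>Ts. list_all2 (typing R) ss Ts \<and>
      (\<forall>(q, B)\<in>set P.
        rat_of_nat (card {i. i < length ss \<and> subty R (Ts ! i) B}) = q * rat_of_nat (length ss)))"

text \<open>\<open>basic_red R t p t'\<close> is \<open>t \<mapsto>\<^sub>p t'\<close>. List indices start at 0, projections at 1.\<close>

inductive basic_red :: "('a \<Rightarrow> 'a \<Rightarrow> bool) \<Rightarrow> 'a tm \<Rightarrow> rat \<Rightarrow> 'a tm \<Rightarrow> bool"
  for R :: "'a \<Rightarrow> 'a \<Rightarrow> bool" where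
  br_beta: "basic_red R (App (Lam x t) u) 1 (subst t u x)"
| br_choice: "i < length pts \<Longrightarrow> basic_red R (Choice pts) (fst (pts ! i)) (snd (pts ! i))"
| br_iter: "basic_red R (Iter n s) 1 (Tup (replicate n s))"
| br_proj: "1 \<le> i \<Longrightarrow> i \<le> length ss \<Longrightarrow> basic_red R (Proj (Tup ss) i) 1 (ss ! (i - 1))"
| br_trust_tru: "approx R ss P' \<Longrightarrow> D_TV P P' \<le> \<epsilon> \<Longrightarrow> basic_red R (Trust (Tup ss) P \<epsilon>) 1 Tru"
| br_trust_fls: "approx R ss P' \<Longrightarrow> D_TV P P' > \<epsilon> \<Longrightarrow> basic_red R (Trust (Tup ss) P \<epsilon>) 1 Fls"

text \<open>
  The conditions on a rule are part of its left-hand form: \<open>Trust\<close> applied to a tuple to which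
  neither of its two rules applies (for instance a tuple of variables) is not a redex.
\<close>

definition redex :: "('a \<Rightarrow> 'a \<Rightarrow> bool) \<Rightarrow> 'a tm \<Rightarrow> bool" where
  "redex R t \<longleftrightarrow> (\<exists>p t'. basic_red R t p t')"

inductive step :: "('a \<Rightarrow> 'a \<Rightarrow> bool) \<Rightarrow> 'a tm \<Rightarrow> rat \<Rightarrow> 'a tm \<Rightarrow> bool"
  for R :: "'a \<Rightarrow> 'a \<Rightarrow> bool" where
  "basic_red R t p t' \<Longrightarrow> step R t p t'"
| "step R t p t' \<Longrightarrow> step R (Lam x t) p (Lam x t')"
| "step R t p t' \<Longrightarrow> step R (App t u) p (App t' u)"
| "step R u p u' \<Longrightarrow> step R (App t u) p (App t u')"
| "step R t p t' \<Longrightarrow> step R (Choice (xs @ (q, t) # ys)) p (Choice (xs @ (q, t') # ys))"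
| "step R t p t' \<Longrightarrow> step R (Iter n t) p (Iter n t')"
| "step R t p t' \<Longrightarrow> step R (Tup (xs @ t # ys)) p (Tup (xs @ t' # ys))"
| "step R t p t' \<Longrightarrow> step R (Proj t j) p (Proj t' j)"
| "step R t p t' \<Longrightarrow> step R (Trust t P \<epsilon>) p (Trust t' P \<epsilon>)"

definition reduces :: "('a \<Rightarrow> 'a \<Rightarrow> bool) \<Rightarrow> 'a tm \<Rightarrow> 'a tm \<Rightarrow> bool" where
  "reduces R = (\<lambda>t t'. \<exists>p. step R t p t')\<^sup>*\<^sup>*"

inductive subterm :: "'a tm \<Rightarrow> 'a tm \<Rightarrow> bool" where
  "subterm t t"
| "subterm s t \<Longrightarrow> subterm s (Lam x t)"
| "subterm s t \<Longrightarrow> subterm s (App t u)"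
| "subterm s u \<Longrightarrow> subterm s (App t u)"
| "(q, t) \<in> set pts \<Longrightarrow> subterm s t \<Longrightarrow> subterm s (Choice pts)"
| "subterm s t \<Longrightarrow> subterm s (Iter n t)"
| "t \<in> set ts \<Longrightarrow> subterm s t \<Longrightarrow> subterm s (Tup ts)"
| "subterm s t \<Longrightarrow> subterm s (Proj t j)"
| "subterm s t \<Longrightarrow> subterm s (Trust t P \<epsilon>)"

end

theory Submission
  imports Defs
begin

text \<open>
  Turing's argument: contract the redexes of highest degree first, innermost ones first. It does
  not mind variable capture, since the type of a variable is part of its name. Subtyping,
  however, does not respect the size of types, so the degree of a cut cannot be read off the
  annotation of its abstraction. Instead a cut may be given \<^emph>\<open>any\<close> type \<open>Z\<close> lying between the type
  of its abstraction (or tuple) and the type at which it is used. When a cut of type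
  \<open>Z\<close> is contracted, the new cuts can be given components of \<open>Z\<close> as types, and the types
  available for the other cuts remain available, because these intervals can only grow.
  Choices and iterations are eliminated beforehand; \<open>Trust\<close> redexes are contracted at the end.
\<close>

section \<open>Subtyping\<close>

text \<open>Sums may be nested, so they are flattened to their summands that are not sums.\<close>

fun leaves :: "'a ty \<Rightarrow> 'a ty set" where
  "leaves (TSum A B Cs) = leaves A \<union> leaves B \<union> (\<Union>C\<in>set Cs. leaves C)"
| "leaves A = {A}"

text \<open>What subtyping between two types that are not sums says one level down. For atoms and
  \<open>TBool\<close> only the shape is kept, as only arrows and powers get taken apart; hence
  subtyping implies this relation but not conversely.\<close>

fun leaf_le :: "('a \<Rightarrow> 'a \<Rightarrow> bool) \<Rightarrow> 'a ty \<Rightarrow> 'a ty \<Rightarrow> bool" where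
  "leaf_le R (Atom q) (Atom q') = True"
| "leaf_le R (Arr A B) (Arr C D) = (subty R C A \<and> subty R B D)"
| "leaf_le R (Pow A m) (Pow B n) = (subty R A B \<and> n \<le> m)"
| "leaf_le R (TBool P \<epsilon>) (TBool P' \<epsilon>') = True"
| "leaf_le R A B = False"

lemma leaves_oplus: "As \<noteq> [] \<Longrightarrow> leaves (oplus As) = (\<Union>A\<in>set As. leaves A)"
  by (cases As rule: oplus.cases) auto

lemma leaf_not_sum: "a \<in> leaves A \<Longrightarrow> a \<noteq> TSum B C Ds"
  by (induction A rule: leaves.induct) auto

lemma leaf_le_refl: "(\<And>B C Ds. a \<noteq> TSum B C Ds) \<Longrightarrow> leaf_le R a a"
  by (cases a) (auto intro: sub_refl)

lemma leaf_le_trans: "leaf_le R a b \<Longrightarrow> leaf_le R b c \<Longrightarrow> leaf_le R a c"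
  by (cases a; cases b; cases c) (auto intro: sub_trans)

text \<open>Transitivity blocks a direct inversion of \<open>subty\<close>, since the middle type
  may be a sum. The induction passes because \<open>leaf_le\<close> is itself transitive. On arrows
  and powers this is the inversion principle for subtyping.\<close>

lemma subty_leaves: "subty R A B \<Longrightarrow> \<forall>a\<in>leaves A. \<exists>b\<in>leaves B. leaf_le R a b"
proof (induction rule: subty.induct)
  case (sub_refl A)
  then show ?case using leaf_not_sum leaf_le_refl by blast
next
  case (sub_trans A B C)
  then show ?case using leaf_le_trans by blast
next
  case (sub_sum As Bs)
  then show ?case by (fastforce simp: leaves_oplus)
qed auto

lemma subty_oplus: "A \<in> set As \<Longrightarrow> subty R A (oplus As)"
  using sub_sum[of "[A]" As R] sub_refl[of R A] by (cases "As = []") auto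

lemma oplus_subty: "As \<noteq> [] \<Longrightarrow> (\<And>A. A \<in> set As \<Longrightarrow> subty R A B) \<Longrightarrow> subty R (oplus As) B"
  using sub_sum[of As "[B]" R] by auto

lemma leaf_subty: "a \<in> leaves A \<Longrightarrow> subty R a A"
proof (induction A rule: leaves.induct)
  case (1 A B Cs)
  have "X \<in> set (A # B # Cs) \<Longrightarrow> subty R X (TSum A B Cs)" for X
    using subty_oplus[of X "A # B # Cs" R] by simp
  with 1 show ?case by (auto intro: sub_trans)
qed (auto intro: sub_refl)

lemma leaf_size: "a \<in> leaves A \<Longrightarrow> size a \<le> size A"
proof (induction A rule: leaves.induct)
  case (1 A B Cs)
  have "size C \<le> size_list size Cs" if "C \<in> set Cs" for C
    using that by (simp add: size_list_estimation')
  with 1 show ?case by fastforce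
qed auto

text \<open>\<open>Z\<close> may be a sum. Some leaf of it lies above \<open>Arr W S\<close>, hence
  is an arrow, and it lies below \<open>Arr C D\<close>, which is its own only leaf. The two
  components of this arrow interpolate.\<close>

lemma Arr_interpolant:
  assumes "subty R (Arr W S) Z" "subty R Z (Arr C D)"
  obtains C' D' where "subty R C C'" "subty R C' W" "subty R S D'" "subty R D' D"
    "size C' < size Z" "size D' < size Z"
proof -
  obtain b where b: "b \<in> leaves Z" "leaf_le R (Arr W S) b"
    using subty_leaves[OF assms(1)] by auto
  then obtain C' D' where bD: "b = Arr C' D'" by (cases b) auto
  have "leaf_le R b (Arr C D)"
    using subty_leaves[OF assms(2)] b(1) by auto
  with b bD leaf_size[OF b(1)] show thesis
    by (intro that[of C' D']) auto
qed

lemma Pow_interpolant: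
  assumes "subty R (Pow E m) Z" "subty R Z (Pow B n)"
  obtains E' where "subty R E E'" "subty R E' B" "n \<le> m" "size E' < size Z"
proof -
  obtain b where b: "b \<in> leaves Z" "leaf_le R (Pow E m) b"
    using subty_leaves[OF assms(1)] by auto
  then obtain E' k where bD: "b = Pow E' k" by (cases b) auto
  have "leaf_le R b (Pow B n)"
    using subty_leaves[OF assms(2)] b(1) by auto
  with b bD leaf_size[OF b(1)] show thesis
    by (intro that[of E']) auto
qed

text \<open>Excludes abstractions under a projection and tuples in function position.\<close>

lemma not_subty_Arr_Pow: "\<not> subty R (Arr A B) (Pow C n)"
  and not_subty_Pow_Arr: "\<not> subty R (Pow C n) (Arr A B)"
  by (auto dest: subty_leaves)


section \<open>Typing with bounded cuts\<close>

fun is_intro :: "'a tm \<Rightarrow> bool" where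
  "is_intro (Lam x t) = True"
| "is_intro (Tup ts) = True"
| "is_intro t = False"

lemma is_intro_cases:
  assumes "is_intro t"
  obtains x t' where "t = Lam x t'" | ts where "t = Tup ts"
  using assms by (cases t) auto

text \<open>
  \<open>cut_typing R k t A\<close>: with subsumption built into every rule, \<open>t\<close> has type \<open>A\<close>, and all its cuts
  can be given types of size less than \<open>k\<close>. Terms such as \<open>Tru\<close> that never create a cut are given
  every type.
\<close>

inductive cut_typing :: "('a \<Rightarrow> 'a \<Rightarrow> bool) \<Rightarrow> nat \<Rightarrow> 'a tm \<Rightarrow> 'a ty \<Rightarrow> bool"
  for R :: "'a \<Rightarrow> 'a \<Rightarrow> bool" and k :: nat where
  ct_var: "subty R B A \<Longrightarrow> cut_typing R k (Var (x, B)) A"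
| ct_tru: "cut_typing R k Tru A"
| ct_fls: "cut_typing R k Fls A"
| ct_lam: "cut_typing R k t B \<Longrightarrow> subty R (Arr W B) A \<Longrightarrow> cut_typing R k (Lam (x, W) t) A"
| ct_app: "cut_typing R k u Z \<Longrightarrow> subty R Z (Arr C D) \<Longrightarrow> cut_typing R k v C \<Longrightarrow> subty R D A
    \<Longrightarrow> (is_intro u \<Longrightarrow> size Z < k) \<Longrightarrow> cut_typing R k (App u v) A"
| ct_tup: "(\<forall>s\<in>set ss. cut_typing R k s E) \<Longrightarrow> subty R (Pow E (length ss)) A
    \<Longrightarrow> cut_typing R k (Tup ss) A"
| ct_proj: "cut_typing R k t Z \<Longrightarrow> subty R Z (Pow B n) \<Longrightarrow> 1 \<le> j \<Longrightarrow> j \<le> n \<Longrightarrow> subty R B A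
    \<Longrightarrow> (is_intro t \<Longrightarrow> size Z < k) \<Longrightarrow> cut_typing R k (Proj t j) A"
| ct_trust: "cut_typing R k t B \<Longrightarrow> cut_typing R k (Trust t P \<epsilon>) A"

inductive_cases ct_lamE: "cut_typing R k (Lam x t) A"
inductive_cases ct_tupE: "cut_typing R k (Tup ss) A"
inductive_cases ct_varE: "cut_typing R k (Var x) A"

text \<open>Each rule either allows every type or has a subtyping premise for its result that can be
  prolonged, so a case distinction suffices.\<close>

lemma cut_typing_sub:
  assumes "cut_typing R k t A" "subty R A B"
  shows "cut_typing R k t B"
  using assms by (cases rule: cut_typing.cases) (auto intro: cut_typing.intros sub_trans)

lemma cut_typing_mono: "cut_typing R k t A \<Longrightarrow> k \<le> l \<Longrightarrow> cut_typing R l t A"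
  by (induction rule: cut_typing.induct) (auto intro: cut_typing.intros less_le_trans)

lemma is_intro_subst: "is_intro (subst t s x) \<Longrightarrow> is_intro t \<or> t = Var x"
  by (cases t) (auto split: if_splits)

text \<open>New cuts arise only where the variable is the head of an elimination, and
  \<open>C\<close> can serve as their type. Capture is harmless because there is no typing context:
  a variable carries its type.\<close>

lemma cut_typing_subst:
  assumes "cut_typing R k t A" "cut_typing R k s C" "subty R C W" "size C < k"
  shows "cut_typing R k (subst t s (x, W)) A"
proof -
  \<comment> \<open>The new type \<open>Z'\<close> of the head is \<open>C\<close> if the head is
    the substituted variable, and \<open>Z\<close> otherwise.\<close>
  have head_interpolant: "\<exists>Z'. cut_typing R k (subst u s (x, W)) Z' \<and> subty R Z' Z
      \<and> (is_intro (subst u s (x, W)) \<longrightarrow> size Z' < k)"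
    if "cut_typing R k u Z" "cut_typing R k (subst u s (x, W)) Z" "is_intro u \<Longrightarrow> size Z < k" for u Z
  proof (cases "u = Var (x, W)")
    case True
    then have "subty R W Z" using that(1) by (auto elim: ct_varE)
    with True assms show ?thesis by (auto intro: sub_trans)
  next
    case False
    then show ?thesis using that is_intro_subst[of u s "(x, W)"] by (auto intro: sub_refl)
  qed
  show ?thesis
    using assms(1)
  proof (induction rule: cut_typing.induct)
    case (ct_var B A y)
    then show ?case
      using assms by (auto intro: cut_typing_sub cut_typing.ct_var sub_trans)
  next
    case (ct_app u Z C D v A)
    from head_interpolant[OF ct_app.hyps(1) ct_app.IH(1) ct_app.hyps(5)] ct_app show ?case
      by (auto intro: cut_typing.ct_app sub_trans)
  next
    case (ct_proj t Z B n j A)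
    from head_interpolant[OF ct_proj.hyps(1) ct_proj.IH ct_proj.hyps(6)] ct_proj show ?case
      by (auto intro: cut_typing.ct_proj sub_trans)
  next
    case (ct_tup ss E A)
    then show ?case by (auto intro!: cut_typing.ct_tup[where E = E])
  qed (auto intro: cut_typing.intros)
qed


section \<open>Many-step reduction\<close>

lemma reduces_refl: "reduces R t t"
  by (simp add: reduces_def)

lemma reduces_trans: "reduces R s t \<Longrightarrow> reduces R t u \<Longrightarrow> reduces R s u"
  by (simp add: reduces_def)

lemma basic_red_reduces: "basic_red R t p t' \<Longrightarrow> reduces R t t'"
  by (auto simp: reduces_def intro: step.intros)

lemma reduces_context:
  assumes "\<And>a b p. step R a p b \<Longrightarrow> step R (f a) p (f b)" "reduces R t t'"
  shows "reduces R (f t) (f t')"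
  using assms(2) unfolding reduces_def
  by (induction rule: rtranclp_induct) (auto intro: rtranclp.rtrancl_into_rtrancl assms(1))

lemma reduces_Lam: "reduces R t t' \<Longrightarrow> reduces R (Lam x t) (Lam x t')"
  by (rule reduces_context[where f = "Lam x"]) (rule step.intros)

lemma reduces_App:
  assumes "reduces R u u'" "reduces R v v'"
  shows "reduces R (App u v) (App u' v')"
proof -
  have "reduces R (App u v) (App u' v)"
    using assms(1) by (rule reduces_context[where f = "\<lambda>u. App u v", rotated]) (rule step.intros)
  moreover have "reduces R (App u' v) (App u' v')"
    using assms(2) by (rule reduces_context[rotated]) (rule step.intros)
  ultimately show ?thesis by (rule reduces_trans)
qed

lemma reduces_Iter: "reduces R t t' \<Longrightarrow> reduces R (Iter n t) (Iter n t')"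
  by (rule reduces_context[where f = "Iter n"]) (rule step.intros)

lemma reduces_Proj: "reduces R t t' \<Longrightarrow> reduces R (Proj t j) (Proj t' j)"
  by (rule reduces_context[where f = "\<lambda>t. Proj t j"]) (rule step.intros)

lemma reduces_Trust: "reduces R t t' \<Longrightarrow> reduces R (Trust t P \<epsilon>) (Trust t' P \<epsilon>)"
  by (rule reduces_context[where f = "\<lambda>t. Trust t P \<epsilon>"]) (rule step.intros)

lemma reduces_Tup:
  assumes "list_all2 (reduces R) ss ss'"
  shows "reduces R (Tup ss) (Tup ss')"
proof -
  \<comment> \<open>The prefix \<open>rs\<close> collects the components already reduced.\<close>
  have "reduces R (Tup (rs @ ss)) (Tup (rs @ ss'))" for rs
    using assms
  proof (induction arbitrary: rs rule: list_all2_induct)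
    case (Cons s ss s' ss')
    have "reduces R (Tup (rs @ s # ss)) (Tup (rs @ s' # ss))"
      using Cons.hyps(1)
      by (rule reduces_context[where f = "\<lambda>s. Tup (rs @ s # ss)", rotated]) (rule step.intros)
    with Cons.IH[of "rs @ [s']"] show ?case by (auto intro: reduces_trans)
  qed (simp add: reduces_refl)
  from this[of "[]"] show ?thesis by simp
qed

lemma reduces_Tup_ex:
  assumes "\<forall>s\<in>set ss. \<exists>s'. reduces R s s' \<and> Q s'"
  obtains ss' where "reduces R (Tup ss) (Tup ss')" "length ss' = length ss" "\<forall>s\<in>set ss'. Q s"
proof -
  obtain f where f: "\<forall>s\<in>set ss. reduces R s (f s) \<and> Q (f s)"
    using assms by metis
  then have "reduces R (Tup ss) (Tup (map f ss))"
    by (intro reduces_Tup) (auto simp: list_all2_conv_all_nth)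
  with f show thesis by (intro that[of "map f ss"]) auto
qed


section \<open>Elimination of choices and iterations\<close>

text \<open>Choices collapse to their first branch and iterations unfold into tuples of copies.
  Finitely many cuts remain, so some \<open>k\<close> bounds their types.\<close>

lemma typing_cut_typing:
  "typing R t T \<Longrightarrow> \<exists>t' k. reduces R t t' \<and> cut_typing R k t' T"
proof (induction rule: typing.induct)
  case (ty_var A x)
  then show ?case using reduces_refl ct_var sub_refl by blast
next
  case (ty_tru P \<epsilon>)
  then show ?case using reduces_refl ct_tru by blast
next
  case (ty_fls P \<epsilon>)
  then show ?case using reduces_refl ct_fls by blast
next
  case (ty_lam t B A x)
  then show ?case using reduces_Lam ct_lam sub_refl by blast
next
  case (ty_choice pts As A)
  then obtain p t pts' where pts: "pts = (p, t) # pts'" by (cases pts) auto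
  with ty_choice.IH obtain B t' k where B: "B \<in> set As" "reduces R t t'" "cut_typing R k t' B"
    by (force simp: list_all2_Cons1)
  have "reduces R (Choice pts) t"
    using br_choice[of 0 pts R] by (auto simp: pts intro: basic_red_reduces)
  with B show ?case by (meson reduces_trans cut_typing_sub subty_oplus)
next
  case (ty_app CDs u v C)
  let ?Z = "oplus (map (\<lambda>(C, D). Arr C D) CDs)"
  obtain u' k where u: "reduces R u u'" "cut_typing R k u' ?Z" using ty_app by blast
  obtain v' l where v: "reduces R v v'" "cut_typing R l v' C" using ty_app by blast
  \<comment> \<open>By contravariance in the argument, a sum of arrows can be used as one arrow from
    \<open>C\<close> into the sum of the results.\<close>
  have "subty R (Arr C' D') (Arr C (oplus (map snd CDs)))" if "(C', D') \<in> set CDs" for C' D'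
    using that ty_app.hyps(4) by (intro sub_arr subty_oplus) force+
  then have "subty R ?Z (Arr C (oplus (map snd CDs)))"
    using ty_app.hyps(1) by (intro oplus_subty) auto
  \<comment> \<open>\<open>Suc (size ?Z)\<close> makes room for the cut formed by this application
    itself.\<close>
  moreover define m where "m = max (max k l) (Suc (size ?Z))"
  ultimately have "cut_typing R m (App u' v') (oplus (map snd CDs))"
    using u v by (intro ct_app[of _ _ _ ?Z C]) (auto intro: cut_typing_mono sub_refl)
  then show ?case using u v reduces_App by blast
next
  case (ty_iter t A n)
  then obtain t' k where t: "reduces R t t'" "cut_typing R k t' A" by blast
  have "reduces R (Iter n t) (Tup (replicate n t'))"
    using reduces_Iter[OF t(1)] basic_red_reduces[OF br_iter] reduces_trans by blast
  moreover have "cut_typing R k (Tup (replicate n t')) (Pow A n)"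
    using t by (intro ct_tup[of _ _ _ A]) (auto intro: sub_refl)
  ultimately show ?case by blast
next
  case (ty_tup ss Es E)
  have "\<exists>s' k. reduces R s s' \<and> cut_typing R k s' E" if "s \<in> set ss" for s
    using ty_tup.IH ty_tup.hyps(3) that by (fastforce simp: list_all2_conv_all_nth in_set_conv_nth intro: cut_typing_sub)
  then obtain ss' where ss': "reduces R (Tup ss) (Tup ss')" "length ss' = length ss"
    "\<forall>s\<in>set ss'. \<exists>k. cut_typing R k s E"
    using reduces_Tup_ex[of ss R "\<lambda>s. \<exists>k. cut_typing R k s E"] by blast
  then obtain f where f: "\<forall>s\<in>set ss'. cut_typing R (f s) s E" by metis
  have "cut_typing R (Max (f ` set ss')) (Tup ss') (Pow E (length ss))"
    using f ss'(2) by (intro ct_tup[of _ _ _ E]) (auto intro: sub_refl cut_typing_mono)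
  with ss' show ?case by blast
next
  case (ty_proj t A n j)
  then obtain t' k where t: "reduces R t t'" "cut_typing R k t' (Pow A n)" by blast
  define m where "m = max k (Suc (size (Pow A n)))"
  have "cut_typing R m (Proj t' j) A"
    using t ty_proj by (intro ct_proj[of _ _ _ "Pow A n" A n]) (auto simp: m_def intro: cut_typing_mono sub_refl)
  then show ?case using t reduces_Proj by blast
next
  case (ty_trust t A n P \<epsilon>)
  then show ?case using reduces_Trust ct_trust by blast
qed


section \<open>Elimination of the largest cuts\<close>

text \<open>
  The last conjunct bounds the cut that arises if \<open>t\<close> stands in the head of an elimination and
  only becomes an introduction by the reduction.
\<close>

lemma cut_typing_reduce:
  "cut_typing R (Suc k) t A \<Longrightarrow> \<exists>t'. reduces R t t' \<and> cut_typing R k t' A \<and>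
     (is_intro t' \<longrightarrow> is_intro t \<or> (\<exists>Z. cut_typing R k t' Z \<and> subty R Z A \<and> size Z < k))"
proof (induction rule: cut_typing.induct)
  case (ct_var B A x)
  then show ?case using reduces_refl cut_typing.ct_var is_intro.simps by blast
next
  case (ct_tru A)
  then show ?case using reduces_refl cut_typing.ct_tru is_intro.simps by blast
next
  case (ct_fls A)
  then show ?case using reduces_refl cut_typing.ct_fls is_intro.simps by blast
next
  case (ct_lam t B W A x)
  then show ?case using reduces_Lam cut_typing.ct_lam is_intro.simps by blast
next
  case (ct_app u Z C D v A)
  obtain u' where u: "reduces R u u'" "cut_typing R k u' Z"
    "is_intro u' \<longrightarrow> is_intro u \<or> (\<exists>Z'. cut_typing R k u' Z' \<and> subty R Z' Z \<and> size Z' < k)"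
    using ct_app.IH(1) by blast
  obtain v' where v: "reduces R v v'" "cut_typing R k v' C" using ct_app.IH(2) by blast
  have red: "reduces R (App u v) (App u' v')" using u v by (intro reduces_App)
  show ?case
  \<comment> \<open>A cut present before the reduction of \<open>u\<close> is contracted, whatever
    its size. A cut created by that reduction is kept: the induction hypothesis types it below
    \<open>k\<close>.\<close>
  proof (cases "is_intro u' \<and> is_intro u")
    case True
    then have size: "size Z \<le> k" using ct_app.hyps(5) by auto
    from True obtain x W r where "u' = Lam (x, W) r"
      using u(2) ct_app.hyps(2) by (auto elim!: is_intro_cases ct_tupE dest: sub_trans simp: not_subty_Pow_Arr)
    with u(2) obtain S where u': "u' = Lam (x, W) r" "cut_typing R k r S" "subty R (Arr W S) Z"
      by (auto elim: ct_lamE)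
    obtain C' D' where CD: "subty R C C'" "subty R C' W" "subty R S D'" "subty R D' D"
      "size C' < size Z" "size D' < size Z"
      using Arr_interpolant[OF u'(3) ct_app.hyps(2)] by blast
    \<comment> \<open>The argument is retyped with the interpolant \<open>C'\<close>, since
      \<open>size C' < size Z \<le> k\<close>; neither \<open>C\<close> nor \<open>W\<close> need be
      small.\<close>
    have "cut_typing R k (subst r v' (x, W)) S"
      using u'(2) v(2) CD size by (intro cut_typing_subst[of _ _ _ _ _ C']) (auto intro: cut_typing_sub)
    then have "cut_typing R k (subst r v' (x, W)) D'" using CD(3) by (rule cut_typing_sub)
    moreover have "subty R D' A" using CD(4) ct_app.hyps(4) by (blast intro: sub_trans)
    moreover have "reduces R (App u v) (subst r v' (x, W))"
      using red basic_red_reduces[OF br_beta] unfolding u'(1) by (rule reduces_trans)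
    \<comment> \<open>\<open>D'\<close> is the witness for the last conjunct, in case the contractum
      is an introduction.\<close>
    ultimately show ?thesis using CD(6) size cut_typing_sub by fastforce
  next
    case False
    then obtain Z' where "cut_typing R k u' Z'" "subty R Z' Z" "is_intro u' \<Longrightarrow> size Z' < k"
      using u sub_refl by blast
    then have "cut_typing R k (App u' v') A"
      using v(2) ct_app by (intro cut_typing.ct_app[of _ _ _ Z' C D]) (auto intro: sub_trans)
    with red show ?thesis by force
  qed
next
  case (ct_tup ss E A)
  then obtain ss' where "reduces R (Tup ss) (Tup ss')" "length ss' = length ss"
    "\<forall>s\<in>set ss'. cut_typing R k s E"
    using reduces_Tup_ex[of ss R "\<lambda>s. cut_typing R k s E"] by blast
  moreover from this have "cut_typing R k (Tup ss') A"
    using ct_tup.hyps by (intro cut_typing.ct_tup[of _ _ _ E]) auto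
  ultimately show ?case by auto
next
  case (ct_proj t Z B n j A)
  obtain t' where t: "reduces R t t'" "cut_typing R k t' Z"
    "is_intro t' \<longrightarrow> is_intro t \<or> (\<exists>Z'. cut_typing R k t' Z' \<and> subty R Z' Z \<and> size Z' < k)"
    using ct_proj.IH by blast
  have red: "reduces R (Proj t j) (Proj t' j)" using t by (intro reduces_Proj)
  show ?case
  proof (cases "is_intro t' \<and> is_intro t")
    case True
    then have size: "size Z \<le> k" using ct_proj.hyps(6) by auto
    from True obtain ss where "t' = Tup ss"
      using t(2) ct_proj.hyps(2) by (auto elim!: is_intro_cases ct_lamE dest: sub_trans simp: not_subty_Arr_Pow)
    with t(2) obtain E where t': "t' = Tup ss" "\<forall>s\<in>set ss. cut_typing R k s E"
      "subty R (Pow E (length ss)) Z"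
      by (auto elim: ct_tupE)
    obtain E' where E: "subty R E E'" "subty R E' B" "n \<le> length ss" "size E' < size Z"
      using Pow_interpolant[OF t'(3) ct_proj.hyps(2)] by blast
    have j: "j \<le> length ss" using E(3) ct_proj.hyps(4) by simp
    then have "ss ! (j - 1) \<in> set ss" using ct_proj.hyps(3) by (intro nth_mem) auto
    \<comment> \<open>As in the application case, the contractum gets a component of the cut type,
      here \<open>E'\<close>, which is smaller than \<open>Z\<close>.\<close>
    then have "cut_typing R k (ss ! (j - 1)) E'" using t'(2) E(1) cut_typing_sub by blast
    moreover have "subty R E' A" using E(2) ct_proj.hyps(5) by (blast intro: sub_trans)
    moreover have "reduces R (Proj t j) (ss ! (j - 1))"
      using red basic_red_reduces[OF br_proj[OF ct_proj.hyps(3) j]] unfolding t'(1) by (rule reduces_trans)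
    ultimately show ?thesis using E(4) size cut_typing_sub by fastforce
  next
    case False
    then obtain Z' where "cut_typing R k t' Z'" "subty R Z' Z" "is_intro t' \<Longrightarrow> size Z' < k"
      using t sub_refl by blast
    then have "cut_typing R k (Proj t' j) A"
      using ct_proj by (intro cut_typing.ct_proj[of _ _ _ Z' B n]) (auto intro: sub_trans)
    with red show ?thesis by force
  qed
next
  case (ct_trust t B P \<epsilon> A)
  then obtain t' where "reduces R t t'" "cut_typing R k t' B" by blast
  then show ?case using reduces_Trust cut_typing.ct_trust is_intro.simps(10) by blast
qed

text \<open>Each pass lowers the bound by one. At bound 0 no type is small enough for a cut, so no
  head of an elimination is an introduction.\<close>

lemma cut_elimination: "cut_typing R k t A \<Longrightarrow> \<exists>t'. reduces R t t' \<and> cut_typing R 0 t' A"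
proof (induction k arbitrary: t)
  case 0
  then show ?case using reduces_refl by blast
next
  case (Suc k)
  from cut_typing_reduce[OF Suc.prems] obtain t' where "reduces R t t'" "cut_typing R k t' A" by blast
  with Suc.IH show ?case by (blast intro: reduces_trans)
qed


section \<open>Elimination of \<open>Trust\<close> redexes\<close>

definition normal :: "('a \<Rightarrow> 'a \<Rightarrow> bool) \<Rightarrow> 'a tm \<Rightarrow> bool" where
  "normal R t \<longleftrightarrow> \<not> (\<exists>s. subterm s t \<and> redex R s)"

inductive_cases subtermE:
  "subterm s Tru" "subterm s Fls" "subterm s (Var x)" "subterm s (Lam x t)" "subterm s (App u v)"
  "subterm s (Tup ts)" "subterm s (Proj t j)" "subterm s (Trust t P \<epsilon>)"

inductive_cases basic_redE:
  "basic_red R Tru p t'" "basic_red R Fls p t'" "basic_red R (Var x) p t'"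
  "basic_red R (Lam x t) p t'" "basic_red R (App u v) p t'" "basic_red R (Tup ts) p t'"
  "basic_red R (Proj t j) p t'"

lemma normal_simps:
  "normal R Tru" "normal R Fls" "normal R (Var x)"
  "normal R t \<Longrightarrow> normal R (Lam x t)"
  "normal R u \<Longrightarrow> normal R v \<Longrightarrow> \<not> is_intro u \<Longrightarrow> normal R (App u v)"
  "\<forall>s\<in>set ss. normal R s \<Longrightarrow> normal R (Tup ss)"
  "normal R t \<Longrightarrow> \<not> is_intro t \<Longrightarrow> normal R (Proj t j)"
  "normal R t \<Longrightarrow> \<not> redex R (Trust t P \<epsilon>) \<Longrightarrow> normal R (Trust t P \<epsilon>)"
  by (auto simp: normal_def redex_def elim!: subtermE elim: basic_redE)

lemma Trust_reduct:
  "redex R (Trust t P \<epsilon>) \<Longrightarrow> \<exists>b. reduces R (Trust t P \<epsilon>) b \<and> (b = Tru \<or> b = Fls)"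
  unfolding redex_def by (auto elim!: basic_red.cases intro: basic_red_reduces basic_red.intros)

text \<open>Only \<open>Trust\<close> redexes are left, and they yield constants, never
  introductions. The last conjunct records this, so that no application or projection becomes a
  redex.\<close>

lemma cut_free_normalizing:
  "cut_typing R 0 t A \<Longrightarrow> \<exists>t'. reduces R t t' \<and> normal R t' \<and> (is_intro t' \<longrightarrow> is_intro t)"
proof (induction rule: cut_typing.induct)
  case (ct_var B A x)
  then show ?case using reduces_refl normal_simps(3) by blast
next
  case (ct_tru A)
  then show ?case using reduces_refl normal_simps(1) by blast
next
  case (ct_fls A)
  then show ?case using reduces_refl normal_simps(2) by blast
next
  case (ct_lam t B W A x)
  then show ?case using reduces_Lam normal_simps(4) is_intro.simps(1) by blast
next
  case (ct_app u Z C D v A)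
  have "\<not> is_intro u" using ct_app.hyps(5) by auto
  with ct_app.IH obtain u' v' where "reduces R u u'" "normal R u'" "\<not> is_intro u'"
    "reduces R v v'" "normal R v'"
    by blast
  then have "reduces R (App u v) (App u' v')" "normal R (App u' v')"
    by (auto intro: reduces_App normal_simps(5))
  then show ?case by fastforce
next
  case (ct_tup ss E A)
  then have "\<forall>s\<in>set ss. \<exists>s'. reduces R s s' \<and> normal R s'" by blast
  then obtain ss' where "reduces R (Tup ss) (Tup ss')" "\<forall>s\<in>set ss'. normal R s"
    by (rule reduces_Tup_ex)
  moreover from this have "normal R (Tup ss')" by (intro normal_simps(6))
  ultimately show ?case by auto
next
  case (ct_proj t Z B n j A)
  have "\<not> is_intro t" using ct_proj.hyps(6) by auto
  with ct_proj.IH obtain t' where "reduces R t t'" "normal R t'" "\<not> is_intro t'"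
    by blast
  then have "reduces R (Proj t j) (Proj t' j)" "normal R (Proj t' j)"
    by (auto intro: reduces_Proj normal_simps(7))
  then show ?case by fastforce
next
  case (ct_trust t B P \<epsilon> A)
  then obtain t' where t: "reduces R t t'" "normal R t'" by blast
  show ?case
  \<comment> \<open>This is decided only once the argument is normal: a test on a normal tuple may
    still fail to be a redex.\<close>
  proof (cases "redex R (Trust t' P \<epsilon>)")
    case True
    then obtain b where "reduces R (Trust t' P \<epsilon>) b" "b = Tru \<or> b = Fls"
      using Trust_reduct by blast
    moreover from this have "reduces R (Trust t P \<epsilon>) b"
      using reduces_Trust[OF t(1)] reduces_trans by blast
    moreover have "normal R b" "\<not> is_intro b"
      using \<open>b = Tru \<or> b = Fls\<close> by (auto intro: normal_simps)
    ultimately show ?thesis by blast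
  next
    case False
    with t have "normal R (Trust t' P \<epsilon>)" by (intro normal_simps(8))
    with reduces_Trust[OF t(1)] show ?thesis by fastforce
  qed
qed

theorem mainTheorem3:
  fixes R :: "'a \<Rightarrow> 'a \<Rightarrow> bool" and t :: "'a tm" and T :: "'a ty"
  assumes "typing R t T"
  shows "\<exists>t'. reduces R t t' \<and> \<not> (\<exists>s. subterm s t' \<and> redex R s)"
proof -
  obtain t1 k where t1: "reduces R t t1" "cut_typing R k t1 T"
    using typing_cut_typing[OF assms] by blast
  obtain t2 where t2: "reduces R t1 t2" "cut_typing R 0 t2 T"
    using cut_elimination[OF t1(2)] by blast
  obtain t3 where "reduces R t2 t3" "normal R t3"
    using cut_free_normalizing[OF t2(2)] by blast
  with t1(1) t2(1) show ?thesis
    unfolding normal_def by (blast intro: reduces_trans)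
qed

end
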